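(* Let $\lambda$ be an infinite cardinal and let $S$ be a Hausdorff topological semigroup which contains $\mathscr{I}^{\infty}_\lambda$ as a dense discrete subsemigroup. If $I=S\setminus\mathscr{I}^{\infty}_\lambda\neq\varnothing$, then $I$ is an ideal of $S$.
   Context: For an infinite cardinal $\lambda$ (regarded as a set), $\mathscr{I}_\lambda$ is the symmetric inverse semigroup of all partial one-to-one maps from $\lambda$ to $\lambda$; maps are written on the right and composed left to right: $(x)(\alpha\beta)=((x)\alpha)\beta$ for $x\in\operatorname{dom}(\alpha\beta)=\{y\in\operatorname{dom}\alpha\mid (y)\alpha\in\operatorname{dom}\beta\}$. A map $\alpha\in\mathscr{I}_\lambda$ is almost everywhere the identity if $\lambda\setminus\operatorname{dom}\alpha$ is finite and $(x)\alpha\neq x$ only for finitely many $x\in\operatorname{dom}\alpha$. $\mathscr{I}^{\infty}_\lambda\subseteq\mathscr{I}_\lambda$ is the inverse subsemigroup of all such maps. A topological semigroup is a topological space with a jointly continuous semigroup operation. "Dense discrete subsemigroup" means a subsemigroup that is dense in $S$ and whose subspace topology is discrete. "Ideal" means two-sided ideal. *)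

theory Defs
  imports "HOL-Analysis.Analysis"
begin

definition sym_inv_semigroup :: "'a set \<Rightarrow> ('a \<rightharpoonup> 'a) set" where
  "sym_inv_semigroup L = {\<alpha>. dom \<alpha> \<subseteq> L \<and> ran \<alpha> \<subseteq> L \<and> inj_on \<alpha> (dom \<alpha>)}"

(* Maps act on the right, so the product applies the left factor first,
   whereas the library's (\<circ>\<^sub>m) applies its right argument first. *)
definition pmap_mult :: "('a \<rightharpoonup> 'a) \<Rightarrow> ('a \<rightharpoonup> 'a) \<Rightarrow> ('a \<rightharpoonup> 'a)"  (infixl "\<cdot>\<^sub>p" 70) where
  "\<alpha> \<cdot>\<^sub>p \<beta> = \<beta> \<circ>\<^sub>m \<alpha>"

definition almost_identity_semigroup :: "'a set \<Rightarrow> ('a \<rightharpoonup> 'a) set" where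
  "almost_identity_semigroup L =
     {\<alpha> \<in> sym_inv_semigroup L. finite (L - dom \<alpha>) \<and> finite {x \<in> dom \<alpha>. \<alpha> x \<noteq> Some x}}"

lemma dom_pmap_mult: "dom (\<alpha> \<cdot>\<^sub>p \<beta>) = {y \<in> dom \<alpha>. the (\<alpha> y) \<in> dom \<beta>}"
  by (auto simp: pmap_mult_def map_comp_def split: option.splits)

lemma pmap_mult_apply: "x \<in> dom (\<alpha> \<cdot>\<^sub>p \<beta>) \<Longrightarrow> (\<alpha> \<cdot>\<^sub>p \<beta>) x = \<beta> (the (\<alpha> x))"
  by (auto simp: pmap_mult_def map_comp_def split: option.splits)

lemma pmap_mult_closed:
  assumes "\<alpha> \<in> almost_identity_semigroup L" "\<beta> \<in> almost_identity_semigroup L"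
  shows "\<alpha> \<cdot>\<^sub>p \<beta> \<in> almost_identity_semigroup L"
proof -
  let ?A = "L - dom \<alpha>" and ?B = "L - dom \<beta>"
  let ?M = "{x \<in> dom \<alpha>. \<alpha> x \<noteq> Some x}" and ?N = "{x \<in> dom \<beta>. \<beta> x \<noteq> Some x}"
  have fin: "finite ?A" "finite ?B" "finite ?M" "finite ?N"
    and a: "dom \<alpha> \<subseteq> L" "ran \<alpha> \<subseteq> L" "inj_on \<alpha> (dom \<alpha>)"
    and b: "dom \<beta> \<subseteq> L" "ran \<beta> \<subseteq> L" "inj_on \<beta> (dom \<beta>)"
    using assms by (auto simp: almost_identity_semigroup_def sym_inv_semigroup_def)
  have "dom (\<alpha> \<cdot>\<^sub>p \<beta>) \<subseteq> L"
    using a(1) by (auto simp: dom_pmap_mult)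
  moreover have "ran (\<alpha> \<cdot>\<^sub>p \<beta>) \<subseteq> ran \<beta>"
    by (auto simp: pmap_mult_def map_comp_def ran_def split: option.splits)
  then have "ran (\<alpha> \<cdot>\<^sub>p \<beta>) \<subseteq> L"
    using b(2) by blast
  moreover have "inj_on (\<alpha> \<cdot>\<^sub>p \<beta>) (dom (\<alpha> \<cdot>\<^sub>p \<beta>))"
  proof (rule inj_onI)
    fix x y
    assume x: "x \<in> dom (\<alpha> \<cdot>\<^sub>p \<beta>)" and y: "y \<in> dom (\<alpha> \<cdot>\<^sub>p \<beta>)"
      and eq: "(\<alpha> \<cdot>\<^sub>p \<beta>) x = (\<alpha> \<cdot>\<^sub>p \<beta>) y"
    obtain u v where u: "\<alpha> x = Some u" "u \<in> dom \<beta>" and v: "\<alpha> y = Some v" "v \<in> dom \<beta>"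
      using x y unfolding dom_pmap_mult by force
    have "\<beta> u = \<beta> v" using eq u v by (simp add: pmap_mult_def)
    then have "u = v" using b(3) u(2) v(2) by (meson inj_onD)
    then show "x = y" using a(3) u(1) v(1) by (metis domI inj_onD)
  qed
  moreover have "L - dom (\<alpha> \<cdot>\<^sub>p \<beta>) \<subseteq> ?A \<union> ?M \<union> ?B"
    by (auto simp: dom_pmap_mult)
  then have "finite (L - dom (\<alpha> \<cdot>\<^sub>p \<beta>))"
    using fin by (meson finite_UnI finite_subset)
  moreover have "{x \<in> dom (\<alpha> \<cdot>\<^sub>p \<beta>). (\<alpha> \<cdot>\<^sub>p \<beta>) x \<noteq> Some x} \<subseteq> ?M \<union> ?N"
    by (auto simp: pmap_mult_def map_comp_def split: option.splits)
  then have "finite {x \<in> dom (\<alpha> \<cdot>\<^sub>p \<beta>). (\<alpha> \<cdot>\<^sub>p \<beta>) x \<noteq> Some x}"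
    using fin by (meson finite_UnI finite_subset)
  ultimately show ?thesis
    by (simp add: almost_identity_semigroup_def sym_inv_semigroup_def)
qed

definition semigroup_ideal :: "'s::semigroup_mult set \<Rightarrow> bool" where
  "semigroup_ideal I \<longleftrightarrow> I \<noteq> {} \<and> (\<forall>s. \<forall>x\<in>I. s * x \<in> I \<and> x * s \<in> I)"

end

theory Submission
  imports Defs
begin

text \<open>
  Points of a dense discrete subspace of a Hausdorff space are isolated in the whole space, while
  every neighbourhood of a point outside it meets it in an infinite set. If \<open>s\<close> is in
  \<open>M = \<I>\<^sup>\<infinity>\<^sub>\<lambda>\<close>, \<open>x\<close> is not, and \<open>s x = t\<close> is in \<open>M\<close>, then continuity gives infinitely many
  \<open>u\<close> in \<open>M\<close> with \<open>s u = t\<close>. But the solutions \<open>u\<close> are finitely many: outside the finite set \<open>F\<close> of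
  points moved or omitted by \<open>s\<close> or \<open>t\<close> such a \<open>u\<close> is the identity, so by injectivity it maps \<open>F\<close>
  partially into \<open>F\<close>. If \<open>s\<close> is outside \<open>M\<close> as well, then \<open>s\<close> may be replaced by a nearby element
  of \<open>M\<close> with the same product, because \<open>t\<close> is isolated.
\<close>

text \<open>Discreteness gives an open \<open>U\<close> whose only point in \<open>M\<close> is
  \<open>x\<close>. Since points are closed, \<open>U - {x}\<close> is open; it misses the dense set
  \<open>M\<close>, so it is empty.\<close>

lemma discrete_dense_imp_open_singleton:
  fixes M :: "'s::t1_space set"
  assumes dense: "closure M = UNIV"
    and discrete: "top_of_set M = discrete_topology M"
    and "x \<in> M"
  shows "open {x}"
proof -
  have "openin (top_of_set M) {x}"
    using discrete \<open>x \<in> M\<close> by simp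
  then obtain U where U: "open U" "{x} = M \<inter> U"
    by (auto simp: openin_open)
  have "U - {x} = {}"
  proof (rule ccontr)
    assume "U - {x} \<noteq> {}"
    moreover have "open (U - {x})"
      using U(1) by (simp add: open_delete)
    ultimately have "(U - {x}) \<inter> M \<noteq> {}"
      using dense by (metis open_Int_closure_eq_empty Int_UNIV_right)
    then show False using U(2) by blast
  qed
  then have "U = {x}" using U(2) by blast
  then show ?thesis using U(1) by simp
qed

text \<open>Finite sets are closed, so deleting a finite trace \<open>U \<inter> M\<close> would
  leave an open neighbourhood of \<open>x\<close> that misses the dense set
  \<open>M\<close>.\<close>

lemma dense_nbhd_infinite:
  fixes M :: "'s::t1_space set"
  assumes "closure M = UNIV" and "x \<notin> M" and "open U" and "x \<in> U"
  shows "infinite (U \<inter> M)"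
proof
  assume "finite (U \<inter> M)"
  then have "open (U - U \<inter> M)"
    using \<open>open U\<close> by (intro open_Diff finite_imp_closed)
  moreover have "x \<in> U - U \<inter> M" using assms by blast
  ultimately have "(U - U \<inter> M) \<inter> M \<noteq> {}"
    using assms(1) by (metis open_Int_closure_eq_empty Int_UNIV_right empty_iff)
  then show False by blast
qed

text \<open>The preimage of an isolated point under the continuous multiplication is open, so it
  contains an open box around \<open>(x, y)\<close>.\<close>

lemma open_singleton_prod_nbhds:
  fixes x y :: "'s::topological_semigroup_mult"
  assumes "open {x * y}"
  obtains U V where "open U" "open V" "x \<in> U" "y \<in> V"
    "\<And>u v. u \<in> U \<Longrightarrow> v \<in> V \<Longrightarrow> u * v = x * y"
proof -
  have "open ((\<lambda>p::'s \<times> 's. fst p * snd p) -` {x * y})"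
    by (intro open_vimage assms continuous_intros)
  then obtain U V where "open U" "open V" "(x, y) \<in> U \<times> V"
      "U \<times> V \<subseteq> (\<lambda>p. fst p * snd p) -` {x * y}"
    by (rule open_prod_elim) auto
  then show ?thesis by (intro that[of U V]) auto
qed

lemma semigroup_ideal_compl_discrete_dense:
  fixes M :: "'s::{topological_semigroup_mult, t1_space} set"
  assumes dense: "closure M = UNIV"
    and discrete: "top_of_set M = discrete_topology M"
    and left: "\<And>s t. s \<in> M \<Longrightarrow> t \<in> M \<Longrightarrow> finite {u \<in> M. s * u = t}"
    and right: "\<And>s t. s \<in> M \<Longrightarrow> t \<in> M \<Longrightarrow> finite {u \<in> M. u * s = t}"
    and "UNIV - M \<noteq> {}"
  shows "semigroup_ideal (UNIV - M)"
proof -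
  note isolated = discrete_dense_imp_open_singleton[OF dense discrete]
  note infinite = dense_nbhd_infinite[OF dense]
  have nonempty: "U \<inter> M \<noteq> {}" if "open U" "x \<in> U" for U x
    using that dense by (metis open_Int_closure_eq_empty Int_UNIV_right empty_iff)
  have l: "s * x \<notin> M" if x: "x \<notin> M" for s x
  proof
    assume t: "s * x \<in> M"
    obtain U V where UV: "open U" "open V" "s \<in> U" "x \<in> V"
      and prod: "\<And>u v. u \<in> U \<Longrightarrow> v \<in> V \<Longrightarrow> u * v = s * x"
      using open_singleton_prod_nbhds[OF isolated[OF t]] by metis
    \<comment> \<open>Passing to \<open>s'\<close> treats \<open>s\<close> inside and outside
      \<open>M\<close> alike: all of the infinite set \<open>V \<inter> M\<close> solves an equation
      with both coefficients in \<open>M\<close>.\<close>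
    obtain s' where s': "s' \<in> U" "s' \<in> M" using nonempty UV by blast
    have "V \<inter> M \<subseteq> {v \<in> M. s' * v = s * x}" using prod s' by blast
    then show False
      using left[OF s'(2) t] infinite[OF x UV(2,4)] finite_subset by blast
  qed
  have r: "x * s \<notin> M" if x: "x \<notin> M" for s x
  proof
    assume t: "x * s \<in> M"
    obtain U V where UV: "open U" "open V" "x \<in> U" "s \<in> V"
      and prod: "\<And>u v. u \<in> U \<Longrightarrow> v \<in> V \<Longrightarrow> u * v = x * s"
      using open_singleton_prod_nbhds[OF isolated[OF t]] by metis
    obtain s' where s': "s' \<in> V" "s' \<in> M" using nonempty UV by blast
    have "U \<inter> M \<subseteq> {u \<in> M. u * s' = x * s}" using prod s' by blast
    then show False
      using right[OF s'(2) t] infinite[OF x UV(1,3)] finite_subset by blast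
  qed
  show ?thesis
    using assms(5) l r by (auto simp: semigroup_ideal_def)
qed

text \<open>Such a map is determined by its restriction to \<open>F\<close>, and the graph of that
  restriction is one of the finitely many subsets of \<open>F \<times> F\<close>.\<close>

lemma finite_sym_inv_fixing_cofinite:
  assumes "finite F"
  shows "finite {\<alpha> \<in> sym_inv_semigroup L. \<forall>x \<in> L - F. \<alpha> x = Some x}" (is "finite ?A")
proof (rule finite_imageD)
  let ?g = "\<lambda>\<alpha>. Map.graph (\<alpha> |` F)"
  have "?g \<alpha> \<subseteq> F \<times> F" if "\<alpha> \<in> ?A" for \<alpha>
  proof clarify
    fix x y assume "(x, y) \<in> ?g \<alpha>"
    then have x: "x \<in> F" and xy: "\<alpha> x = Some y"
      by (auto simp: Map.graph_def restrict_map_def split: if_splits)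
    moreover have "y \<in> F"
    proof (rule ccontr)
      \<comment> \<open>A point \<open>y\<close> of \<open>L - F\<close> is fixed, so its value
        \<open>y\<close> is already taken and cannot also be the image of \<open>x\<close>.\<close>
      assume "y \<notin> F"
      moreover have "y \<in> L" using that xy by (auto simp: sym_inv_semigroup_def ran_def)
      ultimately have "\<alpha> y = \<alpha> x" using that xy by auto
      moreover have "inj_on \<alpha> (dom \<alpha>)" using that by (auto simp: sym_inv_semigroup_def)
      ultimately have "y = x" using xy by (metis domI inj_onD)
      then show False using x \<open>y \<notin> F\<close> by blast
    qed
    ultimately show "x \<in> F \<and> y \<in> F" by blast
  qed
  then have "?g ` ?A \<subseteq> Pow (F \<times> F)" by blast
  then show "finite (?g ` ?A)" using assms by (meson finite_Pow_iff finite_SigmaI finite_subset)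
  show "inj_on ?g ?A"
  proof (rule inj_onI, rule ext)
    fix \<alpha> \<beta> x assume ab: "\<alpha> \<in> ?A" "\<beta> \<in> ?A" "?g \<alpha> = ?g \<beta>"
    have eq: "\<alpha> |` F = \<beta> |` F"
    proof
      fix z
      have "(\<alpha> |` F) z = Some y \<longleftrightarrow> (\<beta> |` F) z = Some y" for y
        using ab(3) unfolding Map.graph_def by blast
      then show "(\<alpha> |` F) z = (\<beta> |` F) z" by (metis not_Some_eq)
    qed
    consider "x \<in> F" | "x \<in> L - F" | "x \<notin> L" by blast
    then show "\<alpha> x = \<beta> x"
    proof cases
      case 1
      then show ?thesis using eq by (metis restrict_in)
    next
      case 2
      then show ?thesis using ab by simp
    next
      case 3
      then have "x \<notin> dom \<alpha>" "x \<notin> dom \<beta>" using ab by (auto simp: sym_inv_semigroup_def)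
      then show ?thesis by (simp add: domIff)
    qed
  qed
qed

text \<open>The inequality \<open>\<alpha> x \<noteq> Some x\<close> also holds where
  \<open>\<alpha> x = None\<close>, so omitted and moved points are counted together.\<close>

lemma finite_moved_almost_identity:
  assumes "\<alpha> \<in> almost_identity_semigroup L"
  shows "finite {x \<in> L. \<alpha> x \<noteq> Some x}"
proof (rule finite_subset)
  show "{x \<in> L. \<alpha> x \<noteq> Some x} \<subseteq> (L - dom \<alpha>) \<union> {x \<in> dom \<alpha>. \<alpha> x \<noteq> Some x}" by blast
  show "finite ((L - dom \<alpha>) \<union> {x \<in> dom \<alpha>. \<alpha> x \<noteq> Some x})"
    using assms by (simp add: almost_identity_semigroup_def)
qed

text \<open>Where \<open>\<sigma>\<close> and \<open>\<tau>\<close> both fix \<open>x\<close>,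
  evaluating the equation at \<open>x\<close> gives \<open>\<alpha> x = Some x\<close> at
  once.\<close>

lemma finite_left_solutions:
  assumes "\<sigma> \<in> almost_identity_semigroup L" "\<tau> \<in> almost_identity_semigroup L"
  shows "finite {\<alpha> \<in> almost_identity_semigroup L. \<sigma> \<cdot>\<^sub>p \<alpha> = \<tau>}"
proof (rule finite_subset)
  let ?F = "{x \<in> L. \<sigma> x \<noteq> Some x} \<union> {x \<in> L. \<tau> x \<noteq> Some x}"
  show "finite {\<alpha> \<in> sym_inv_semigroup L. \<forall>x \<in> L - ?F. \<alpha> x = Some x}"
    using assms by (intro finite_sym_inv_fixing_cofinite finite_UnI finite_moved_almost_identity)
  show "{\<alpha> \<in> almost_identity_semigroup L. \<sigma> \<cdot>\<^sub>p \<alpha> = \<tau>}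
      \<subseteq> {\<alpha> \<in> sym_inv_semigroup L. \<forall>x \<in> L - ?F. \<alpha> x = Some x}"
    by (auto simp: almost_identity_semigroup_def pmap_mult_def map_comp_def)
qed

lemma finite_right_solutions:
  assumes "\<sigma> \<in> almost_identity_semigroup L" "\<tau> \<in> almost_identity_semigroup L"
  shows "finite {\<alpha> \<in> almost_identity_semigroup L. \<alpha> \<cdot>\<^sub>p \<sigma> = \<tau>}"
proof (rule finite_subset)
  let ?F = "{x \<in> L. \<sigma> x \<noteq> Some x} \<union> {x \<in> L. \<tau> x \<noteq> Some x}"
  show "finite {\<alpha> \<in> sym_inv_semigroup L. \<forall>x \<in> L - ?F. \<alpha> x = Some x}"
    using assms by (intro finite_sym_inv_fixing_cofinite finite_UnI finite_moved_almost_identity)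
  have "\<alpha> x = Some x" if "\<alpha> \<cdot>\<^sub>p \<sigma> = \<tau>" "x \<in> L - ?F" for \<alpha> x
  proof -
    have x: "\<sigma> x = Some x" "(\<alpha> \<cdot>\<^sub>p \<sigma>) x = Some x" using that by auto
    \<comment> \<open>On this side \<open>\<alpha>\<close> acts first, so the equation only says
      that \<open>\<sigma>\<close> maps the image \<open>y\<close> of \<open>x\<close> to
      \<open>x\<close>. As \<open>\<sigma>\<close> also fixes \<open>x\<close>, its injectivity
      forces \<open>y = x\<close>.\<close>
    then obtain y where y: "\<alpha> x = Some y" "\<sigma> y = Some x"
      by (auto simp: pmap_mult_def map_comp_def split: option.splits)
    moreover have "inj_on \<sigma> (dom \<sigma>)"
      using assms(1) by (simp add: almost_identity_semigroup_def sym_inv_semigroup_def)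
    ultimately have "y = x" using x(1) by (metis domI inj_onD)
    then show ?thesis using y by simp
  qed
  then show "{\<alpha> \<in> almost_identity_semigroup L. \<alpha> \<cdot>\<^sub>p \<sigma> = \<tau>}
      \<subseteq> {\<alpha> \<in> sym_inv_semigroup L. \<forall>x \<in> L - ?F. \<alpha> x = Some x}"
    by (auto simp: almost_identity_semigroup_def)
qed

theorem theorem5p4:
  fixes L :: "'a set"
    and \<iota> :: "('a \<rightharpoonup> 'a) \<Rightarrow> 's::{topological_semigroup_mult, t2_space}"
  assumes "infinite L"
    and "inj_on \<iota> (almost_identity_semigroup L)"
    and "\<And>\<alpha> \<beta>. \<alpha> \<in> almost_identity_semigroup L \<Longrightarrow> \<beta> \<in> almost_identity_semigroup L \<Longrightarrow>
           \<iota> (\<alpha> \<cdot>\<^sub>p \<beta>) = \<iota> \<alpha> * \<iota> \<beta>"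
    and "closure (\<iota> ` almost_identity_semigroup L) = UNIV"
    and "top_of_set (\<iota> ` almost_identity_semigroup L) =
           discrete_topology (\<iota> ` almost_identity_semigroup L)"
    and "UNIV - \<iota> ` almost_identity_semigroup L \<noteq> {}"
  shows "semigroup_ideal (UNIV - \<iota> ` almost_identity_semigroup L)"
proof (rule semigroup_ideal_compl_discrete_dense)
  let ?M = "almost_identity_semigroup L"
  fix s t assume "s \<in> \<iota> ` ?M" "t \<in> \<iota> ` ?M"
  then obtain \<sigma> \<tau> where st: "\<sigma> \<in> ?M" "\<tau> \<in> ?M" "s = \<iota> \<sigma>" "t = \<iota> \<tau>" by blast
  have "{u \<in> \<iota> ` ?M. s * u = t} \<subseteq> \<iota> ` {\<alpha> \<in> ?M. \<sigma> \<cdot>\<^sub>p \<alpha> = \<tau>}"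
  proof
    fix u assume "u \<in> {u \<in> \<iota> ` ?M. s * u = t}"
    then obtain \<alpha> where \<alpha>: "\<alpha> \<in> ?M" "u = \<iota> \<alpha>" and "s * u = t" by blast
    then have "\<iota> (\<sigma> \<cdot>\<^sub>p \<alpha>) = \<iota> \<tau>" using st by (simp add: assms(3))
    \<comment> \<open>Cancelling \<open>\<iota>\<close>, which is injective only on
      \<open>?M\<close>, requires the product to lie in \<open>?M\<close>.\<close>
    then have "\<sigma> \<cdot>\<^sub>p \<alpha> = \<tau>"
      using assms(2) pmap_mult_closed st(1,2) \<alpha>(1) by (meson inj_onD)
    then show "u \<in> \<iota> ` {\<alpha> \<in> ?M. \<sigma> \<cdot>\<^sub>p \<alpha> = \<tau>}" using \<alpha> by blast
  qed
  then show "finite {u \<in> \<iota> ` ?M. s * u = t}"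
    using finite_left_solutions[OF st(1,2)] finite_surj by blast
  have "{u \<in> \<iota> ` ?M. u * s = t} \<subseteq> \<iota> ` {\<alpha> \<in> ?M. \<alpha> \<cdot>\<^sub>p \<sigma> = \<tau>}"
  proof
    fix u assume "u \<in> {u \<in> \<iota> ` ?M. u * s = t}"
    then obtain \<alpha> where \<alpha>: "\<alpha> \<in> ?M" "u = \<iota> \<alpha>" and "u * s = t" by blast
    then have "\<iota> (\<alpha> \<cdot>\<^sub>p \<sigma>) = \<iota> \<tau>" using st by (simp add: assms(3))
    then have "\<alpha> \<cdot>\<^sub>p \<sigma> = \<tau>"
      using assms(2) pmap_mult_closed st(1,2) \<alpha>(1) by (meson inj_onD)
    then show "u \<in> \<iota> ` {\<alpha> \<in> ?M. \<alpha> \<cdot>\<^sub>p \<sigma> = \<tau>}" using \<alpha> by blast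
  qed
  then show "finite {u \<in> \<iota> ` ?M. u * s = t}"
    using finite_right_solutions[OF st(1,2)] finite_surj by blast
qed (use assms in auto)

end
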